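(* Let $B$ and $C$ be non-empty sets, and let $R^B:B\times B\to B\times B$ and $R^C:C\times C\to C\times C$ be maps satisfying the Yang–Baxter equations $$R^B_{12}R^B_{13}R^B_{23}=R^B_{23}R^B_{13}R^B_{12},\qquad R^C_{12}R^C_{13}R^C_{23}=R^C_{23}R^C_{13}R^C_{12}.$$ Let $R:C\times B\to C\times B$ be an invertible map such that $$R^B_{23}R_{12}R_{13}=R_{13}R_{12}R^B_{23}\ \text{ on } C\times B\times B,\qquad R^C_{12}R_{23}R_{13}=R_{13}R_{23}R^C_{12}\ \text{ on } C\times C\times B.$$ Then the map $\mathcal R=R_{41}R^B_{13}R^C_{24}R_{23}^{-1}$ from $(B\times C)\times(B\times C)$ to itself satisfies the Yang–Baxter equation $$\mathcal R_{12}\mathcal R_{13}\mathcal R_{23}=\mathcal R_{23}\mathcal R_{13}\mathcal R_{12}$$ on $(B\times C)^3$, where here the indices refer to the three factors $B\times C$; i.e. $(B\times C,\mathcal R)$ is a Yang–Baxter set.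
   Context: Products of maps denote composition. For a map $T:U\times V\to U\times V$ and a product of sets whose $i$-th factor is $U$ and whose $j$-th factor is $V$, $T_{ij}$ denotes the map which applies $T$ to the pair ($i$-th coordinate, $j$-th coordinate), putting the first component of the result in position $i$ and the second in position $j$, and acts as the identity on the other coordinates. In $(B\times C)\times(B\times C)$ the coordinates are numbered $1,2,3,4$ with factors $B,C,B,C$; so $R_{41}$ applies $R$ to (coordinate 4 in $C$, coordinate 1 in $B$), and $R_{23}^{-1}$ applies $R^{-1}$ to (coordinate 2 in $C$, coordinate 3 in $B$). A Yang–Baxter set is a pair $(X,T)$ with $T:X\times X\to X\times X$ satisfying $T_{12}T_{13}T_{23}=T_{23}T_{13}T_{12}$ on $X^3$. *)

theory Defs
  imports Main
begin

text \<open>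
  The non-empty sets are rendered as types. A product of three sets is the nested product
  \<open>'x \<times> 'y \<times> 'z\<close>, and the product \<open>(B \<times> C) \<times> (B \<times> C)\<close> is \<open>('x \<times> 'y) \<times> ('z \<times> 'w)\<close>, whose
  coordinates are numbered 1, 2, 3, 4 from left to right. A name \<open>triple_ij\<close> or \<open>quad_ij\<close>
  stands for the operation \<open>T \<mapsto> T\<^sub>i\<^sub>j\<close>; as \<open>quad_41\<close> shows, the order of the two indices matters.
\<close>

definition triple_12 :: "('x \<times> 'y \<Rightarrow> 'x \<times> 'y) \<Rightarrow> 'x \<times> 'y \<times> 'z \<Rightarrow> 'x \<times> 'y \<times> 'z" where
  "triple_12 T = (\<lambda>(x, y, z). case T (x, y) of (x', y') \<Rightarrow> (x', y', z))"

definition triple_13 :: "('x \<times> 'z \<Rightarrow> 'x \<times> 'z) \<Rightarrow> 'x \<times> 'y \<times> 'z \<Rightarrow> 'x \<times> 'y \<times> 'z" where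
  "triple_13 T = (\<lambda>(x, y, z). case T (x, z) of (x', z') \<Rightarrow> (x', y, z'))"

definition triple_23 :: "('y \<times> 'z \<Rightarrow> 'y \<times> 'z) \<Rightarrow> 'x \<times> 'y \<times> 'z \<Rightarrow> 'x \<times> 'y \<times> 'z" where
  "triple_23 T = (\<lambda>(x, y, z). case T (y, z) of (y', z') \<Rightarrow> (x, y', z'))"

definition quad_13 ::
  "('x \<times> 'z \<Rightarrow> 'x \<times> 'z) \<Rightarrow> ('x \<times> 'y) \<times> ('z \<times> 'w) \<Rightarrow> ('x \<times> 'y) \<times> ('z \<times> 'w)" where
  "quad_13 T = (\<lambda>((x, y), (z, w)). case T (x, z) of (x', z') \<Rightarrow> ((x', y), (z', w)))"

definition quad_24 ::
  "('y \<times> 'w \<Rightarrow> 'y \<times> 'w) \<Rightarrow> ('x \<times> 'y) \<times> ('z \<times> 'w) \<Rightarrow> ('x \<times> 'y) \<times> ('z \<times> 'w)" where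
  "quad_24 T = (\<lambda>((x, y), (z, w)). case T (y, w) of (y', w') \<Rightarrow> ((x, y'), (z, w')))"

definition quad_23 ::
  "('y \<times> 'z \<Rightarrow> 'y \<times> 'z) \<Rightarrow> ('x \<times> 'y) \<times> ('z \<times> 'w) \<Rightarrow> ('x \<times> 'y) \<times> ('z \<times> 'w)" where
  "quad_23 T = (\<lambda>((x, y), (z, w)). case T (y, z) of (y', z') \<Rightarrow> ((x, y'), (z', w)))"

definition quad_41 ::
  "('w \<times> 'x \<Rightarrow> 'w \<times> 'x) \<Rightarrow> ('x \<times> 'y) \<times> ('z \<times> 'w) \<Rightarrow> ('x \<times> 'y) \<times> ('z \<times> 'w)" where
  "quad_41 T = (\<lambda>((x, y), (z, w)). case T (w, x) of (w', x') \<Rightarrow> ((x', y), (z, w')))"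

text \<open>\<open>yang_baxter T\<close> says that the type \<open>'a\<close> together with \<open>T\<close> is a Yang--Baxter set.\<close>

definition yang_baxter :: "('a \<times> 'a \<Rightarrow> 'a \<times> 'a) \<Rightarrow> bool" where
  "yang_baxter T \<longleftrightarrow>
     triple_12 T \<circ> triple_13 T \<circ> triple_23 T = triple_23 T \<circ> triple_13 T \<circ> triple_12 T"

end

theory Submission
  imports Defs
begin

text \<open>
  Think of \<open>(B \<times> C)\<^sup>3\<close> as three strands, the \<open>i\<close>-th carrying a \<open>B\<close>-coordinate and a
  \<open>C\<close>-coordinate. Write \<open>b\<^sub>i\<^sub>j\<close> and \<open>c\<^sub>i\<^sub>j\<close> for the two Yang--Baxter maps acting on strands \<open>i, j\<close>,
  write \<open>r\<^sub>i\<^sub>j\<close> for \<open>R\<close> acting on the \<open>C\<close>-coordinate of strand \<open>i\<close> and the \<open>B\<close>-coordinate of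
  strand \<open>j\<close>, and \<open>s\<^sub>i\<^sub>j\<close> for the inverse of \<open>r\<^sub>i\<^sub>j\<close>. The map in question, acting on strands
  \<open>i, j\<close>, is the word \<open>r\<^sub>j\<^sub>i b\<^sub>i\<^sub>j c\<^sub>i\<^sub>j s\<^sub>i\<^sub>j\<close>.

  Letters touching disjoint coordinates commute, and the hypotheses on \<open>R\<close> say that \<open>r\<close> can be
  moved past \<open>b\<close> and \<open>c\<close> in pairs. Hence on either side of the Yang--Baxter equation every \<open>r\<close> can
  be moved to the left end and every \<open>s\<close> to the right end, and the two sides become
  \<open>r\<^sub>2\<^sub>1 r\<^sub>3\<^sub>2 r\<^sub>3\<^sub>1 (b\<^sub>1\<^sub>2 b\<^sub>1\<^sub>3 b\<^sub>2\<^sub>3) (c\<^sub>1\<^sub>2 c\<^sub>1\<^sub>3 c\<^sub>2\<^sub>3) s\<^sub>1\<^sub>3 s\<^sub>1\<^sub>2 s\<^sub>2\<^sub>3\<close> and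
  \<open>r\<^sub>2\<^sub>1 r\<^sub>3\<^sub>2 r\<^sub>3\<^sub>1 (b\<^sub>2\<^sub>3 b\<^sub>1\<^sub>3 b\<^sub>1\<^sub>2) (c\<^sub>2\<^sub>3 c\<^sub>1\<^sub>3 c\<^sub>1\<^sub>2) s\<^sub>1\<^sub>3 s\<^sub>1\<^sub>2 s\<^sub>2\<^sub>3\<close>
  (\<open>doubled_left_word\<close> and \<open>doubled_right_word\<close>). The Yang--Baxter equations for \<open>b\<close> and for \<open>c\<close>
  identify these words.

  The letters are defined on families of coordinates indexed by an arbitrary set of strands, so that
  each relation is proved once for all indices; \<open>embed\<close> carries the result back to triples.
\<close>

definition on_BB :: "('b \<times> 'b \<Rightarrow> 'b \<times> 'b) \<Rightarrow> 'i \<Rightarrow> 'i \<Rightarrow> ('i \<Rightarrow> 'b) \<times> ('i \<Rightarrow> 'c) \<Rightarrow> ('i \<Rightarrow> 'b) \<times> ('i \<Rightarrow> 'c)"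
  where "on_BB T i j = (\<lambda>(\<beta>, \<gamma>). (\<beta>(i := fst (T (\<beta> i, \<beta> j)), j := snd (T (\<beta> i, \<beta> j))), \<gamma>))"

definition on_CC :: "('c \<times> 'c \<Rightarrow> 'c \<times> 'c) \<Rightarrow> 'i \<Rightarrow> 'i \<Rightarrow> ('i \<Rightarrow> 'b) \<times> ('i \<Rightarrow> 'c) \<Rightarrow> ('i \<Rightarrow> 'b) \<times> ('i \<Rightarrow> 'c)"
  where "on_CC T i j = (\<lambda>(\<beta>, \<gamma>). (\<beta>, \<gamma>(i := fst (T (\<gamma> i, \<gamma> j)), j := snd (T (\<gamma> i, \<gamma> j)))))"

definition on_CB :: "('c \<times> 'b \<Rightarrow> 'c \<times> 'b) \<Rightarrow> 'i \<Rightarrow> 'i \<Rightarrow> ('i \<Rightarrow> 'b) \<times> ('i \<Rightarrow> 'c) \<Rightarrow> ('i \<Rightarrow> 'b) \<times> ('i \<Rightarrow> 'c)"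
  where "on_CB T i j = (\<lambda>(\<beta>, \<gamma>). (\<beta>(j := snd (T (\<gamma> i, \<beta> j))), \<gamma>(i := fst (T (\<gamma> i, \<beta> j)))))"

lemma on_CB_commute:
  assumes "i \<noteq> k" "j \<noteq> l"
  shows "on_CB S i j (on_CB T k l s) = on_CB T k l (on_CB S i j s)"
  using assms by (cases s) (simp add: on_CB_def fun_upd_twist)

lemma on_CB_on_BB_commute:
  assumes "j \<noteq> k" "j \<noteq> l"
  shows "on_CB S i j (on_BB T k l s) = on_BB T k l (on_CB S i j s)"
  using assms by (cases s) (simp add: on_CB_def on_BB_def fun_upd_twist)

lemma on_CB_on_CC_commute:
  assumes "i \<noteq> k" "i \<noteq> l"
  shows "on_CB S i j (on_CC T k l s) = on_CC T k l (on_CB S i j s)"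
  using assms by (cases s) (simp add: on_CB_def on_CC_def fun_upd_twist)

lemma on_BB_on_CC_commute:
  "on_BB S i j (on_CC T k l s) = on_CC T k l (on_BB S i j s)"
  by (cases s) (simp add: on_BB_def on_CC_def)

lemma on_CB_inverse:
  assumes "bij R"
  shows "on_CB R i j (on_CB (inv R) i j s) = s" "on_CB (inv R) i j (on_CB R i j s) = s"
proof -
  have "R (inv R p) = p" "inv R (R p) = p" for p
    using assms by (simp_all add: bij_is_inj bij_is_surj surj_f_inv_f)
  then show "on_CB R i j (on_CB (inv R) i j s) = s" "on_CB (inv R) i j (on_CB R i j s) = s"
    by (cases s; simp add: on_CB_def)+
qed

lemma on_BB_yang_baxter:
  assumes "yang_baxter T" and d: "i \<noteq> j" "i \<noteq> k" "j \<noteq> k"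
  shows "on_BB T i j (on_BB T i k (on_BB T j k s)) = on_BB T j k (on_BB T i k (on_BB T i j s))"
proof -
  obtain \<beta> \<gamma> where s: "s = (\<beta>, \<gamma>)" by fastforce
  have "(triple_12 T \<circ> triple_13 T \<circ> triple_23 T) (\<beta> i, \<beta> j, \<beta> k)
      = (triple_23 T \<circ> triple_13 T \<circ> triple_12 T) (\<beta> i, \<beta> j, \<beta> k)"
    using assms by (simp add: yang_baxter_def)
  then show ?thesis using d unfolding s
    by (simp add: on_BB_def triple_12_def triple_13_def triple_23_def
        case_prod_beta prod_eq_iff fun_eq_iff)
qed

lemma on_CC_yang_baxter:
  assumes "yang_baxter T" and d: "i \<noteq> j" "i \<noteq> k" "j \<noteq> k"
  shows "on_CC T i j (on_CC T i k (on_CC T j k s)) = on_CC T j k (on_CC T i k (on_CC T i j s))"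
proof -
  obtain \<beta> \<gamma> where s: "s = (\<beta>, \<gamma>)" by fastforce
  have "(triple_12 T \<circ> triple_13 T \<circ> triple_23 T) (\<gamma> i, \<gamma> j, \<gamma> k)
      = (triple_23 T \<circ> triple_13 T \<circ> triple_12 T) (\<gamma> i, \<gamma> j, \<gamma> k)"
    using assms by (simp add: yang_baxter_def)
  then show ?thesis using d unfolding s
    by (simp add: on_CC_def triple_12_def triple_13_def triple_23_def
        case_prod_beta prod_eq_iff fun_eq_iff)
qed

lemma on_BB_mixed:
  assumes "triple_23 RB \<circ> triple_12 R \<circ> triple_13 R = triple_13 R \<circ> triple_12 R \<circ> triple_23 RB"
    and d: "j \<noteq> k"
  shows "on_BB RB j k (on_CB R i j (on_CB R i k s)) = on_CB R i k (on_CB R i j (on_BB RB j k s))"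
proof -
  obtain \<beta> \<gamma> where s: "s = (\<beta>, \<gamma>)" by fastforce
  have "(triple_23 RB \<circ> triple_12 R \<circ> triple_13 R) (\<gamma> i, \<beta> j, \<beta> k)
      = (triple_13 R \<circ> triple_12 R \<circ> triple_23 RB) (\<gamma> i, \<beta> j, \<beta> k)"
    using assms by simp
  then show ?thesis using d unfolding s
    by (simp add: on_BB_def on_CB_def triple_12_def triple_13_def triple_23_def
        case_prod_beta prod_eq_iff fun_eq_iff)
qed

lemma on_CC_mixed:
  assumes "triple_12 RC \<circ> triple_23 R \<circ> triple_13 R = triple_13 R \<circ> triple_23 R \<circ> triple_12 RC"
    and d: "i \<noteq> j"
  shows "on_CC RC i j (on_CB R j k (on_CB R i k s)) = on_CB R i k (on_CB R j k (on_CC RC i j s))"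
proof -
  obtain \<beta> \<gamma> where s: "s = (\<beta>, \<gamma>)" by fastforce
  have "(triple_12 RC \<circ> triple_23 R \<circ> triple_13 R) (\<gamma> i, \<gamma> j, \<beta> k)
      = (triple_13 R \<circ> triple_23 R \<circ> triple_12 RC) (\<gamma> i, \<gamma> j, \<beta> k)"
    using assms by simp
  then show ?thesis using d unfolding s
    by (simp add: on_CC_def on_CB_def triple_12_def triple_13_def triple_23_def
        case_prod_beta prod_eq_iff fun_eq_iff)
qed

text \<open>
  Conjugating an exchange relation by inverses moves one or both of the outer letters to the other
  side of \<open>m\<close>. Here \<open>x, y\<close> stand for two letters \<open>r\<close>, \<open>x', y'\<close> for their inverses, and \<open>m\<close> for
  a letter \<open>b\<close> or \<open>c\<close>.
\<close>

lemma exchange_one_inverse: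
  assumes "\<And>s. m (x (y s)) = y (x (m s))" and "\<And>s. y (y' s) = s" and "\<And>s. y' (y s) = s"
  shows "y' (m (x s)) = x (m (y' s))"
  by (metis assms)

lemma exchange_both_inverses:
  assumes "\<And>s. m (x (y s)) = y (x (m s))"
    and "\<And>s. x (x' s) = s" and "\<And>s. x' (x s) = s"
    and "\<And>s. y (y' s) = s" and "\<And>s. y' (y s) = s"
  shows "x' (y' (m s)) = m (y' (x' s))"
  by (metis assms)

locale mixed_pair =
  fixes RB :: "'b \<times> 'b \<Rightarrow> 'b \<times> 'b"
    and RC :: "'c \<times> 'c \<Rightarrow> 'c \<times> 'c"
    and R :: "'c \<times> 'b \<Rightarrow> 'c \<times> 'b"
  assumes bij: "bij R"
    and mixed_B: "triple_23 RB \<circ> triple_12 R \<circ> triple_13 R = triple_13 R \<circ> triple_12 R \<circ> triple_23 RB"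
    and mixed_C: "triple_12 RC \<circ> triple_23 R \<circ> triple_13 R = triple_13 R \<circ> triple_23 R \<circ> triple_12 RC"
begin

abbreviation b where "b \<equiv> on_BB RB"
abbreviation c where "c \<equiv> on_CC RC"
abbreviation r where "r \<equiv> on_CB R"
abbreviation s where "s \<equiv> on_CB (inv R)"

definition doubled :: "'i \<Rightarrow> 'i \<Rightarrow> ('i \<Rightarrow> 'b) \<times> ('i \<Rightarrow> 'c) \<Rightarrow> ('i \<Rightarrow> 'b) \<times> ('i \<Rightarrow> 'c)" where
  "doubled i j p = r j i (b i j (c i j (s i j p)))"

lemmas b_r_r = on_BB_mixed[OF mixed_B]
lemmas c_r_r = on_CC_mixed[OF mixed_C]

lemma s_b_r: "j \<noteq> k \<Longrightarrow> s i k (b j k (r i j p)) = r i j (b j k (s i k p))"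
  by (rule exchange_one_inverse[where m = "b j k" and x = "r i j" and y = "r i k"])
    (simp_all add: b_r_r on_CB_inverse[OF bij])

lemma s_s_b: "j \<noteq> k \<Longrightarrow> s i j (s i k (b j k p)) = b j k (s i k (s i j p))"
  by (rule exchange_both_inverses[where m = "b j k" and x = "r i j" and y = "r i k"])
    (simp_all add: b_r_r on_CB_inverse[OF bij])

lemma s_c_r: "i \<noteq> j \<Longrightarrow> s i k (c i j (r j k p)) = r j k (c i j (s i k p))"
  by (rule exchange_one_inverse[where m = "c i j" and x = "r j k" and y = "r i k"])
    (simp_all add: c_r_r on_CB_inverse[OF bij])

lemma s_s_c: "i \<noteq> j \<Longrightarrow> s j k (s i k (c i j p)) = c i j (s i k (s j k p))"
  by (rule exchange_both_inverses[where m = "c i j" and x = "r j k" and y = "r i k"])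
    (simp_all add: c_r_r on_CB_inverse[OF bij])

text \<open>
  No \<open>s\<close> meets its own inverse \<open>r\<close> on the way to the right: the doubled maps contribute
  \<open>s\<^sub>i\<^sub>j, s\<^sub>i\<^sub>k, s\<^sub>j\<^sub>k\<close> but \<open>r\<^sub>j\<^sub>i, r\<^sub>k\<^sub>i, r\<^sub>k\<^sub>j\<close>. So \<open>r\<close> and \<open>s\<close> never cancel, and the only
  obstacles are those removed by the exchange relations.
\<close>

lemma doubled_left_word:
  assumes d: "i \<noteq> j" "i \<noteq> k" "j \<noteq> k"
  shows "doubled i j (doubled i k (doubled j k p)) =
    r j i (r k j (r k i (b i j (b i k (b j k (c i j (c i k (c j k (s i k (s i j (s j k p)))))))))))"
proof -
  note d = d d[symmetric]
  have "doubled i j (doubled i k (doubled j k p)) =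
      r j i (b i j (c i j (s i j (r k i (b i k (c i k (s i k (r k j (b j k (c j k (s j k p)))))))))))"
    by (simp only: doubled_def)
  \<comment> \<open>Bring \<open>s\<^sub>i\<^sub>j\<close> next to \<open>c\<^sub>i\<^sub>k r\<^sub>k\<^sub>j\<close>, the only place where it is obstructed by a \<open>c\<close> and an \<open>r\<close>.\<close>
  also have "\<dots> =
      r j i (b i j (c i j (r k i (b i k (s i j (c i k (r k j (s i k (b j k (c j k (s j k p)))))))))))"
    by (simp only: d on_CB_commute[of i k j i] on_CB_commute[of i k k j]
        on_CB_on_BB_commute[of j i k] not_False_eq_True)
  \<comment> \<open>After \<open>s\<^sub>i\<^sub>j\<close> has passed \<open>c\<^sub>i\<^sub>k r\<^sub>k\<^sub>j\<close>, it and \<open>s\<^sub>i\<^sub>k\<close> pass \<open>b\<^sub>j\<^sub>k\<close> together.\<close>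
  also have "\<dots> =
      r j i (b i j (c i j (r k i (b i k (r k j (c i k (b j k (s i k (s i j (c j k (s j k p)))))))))))"
    by (simp only: d s_c_r s_s_b not_False_eq_True)
  \<comment> \<open>Separate the letters \<open>b\<close> from the letters \<open>c\<close>; this leaves only \<open>b\<^sub>i\<^sub>j\<close> in front of two letters \<open>r\<close>.\<close>
  also have "\<dots> =
      r j i (b i j (r k i (r k j (b i k (b j k (c i j (c i k (c j k (s i k (s i j (s j k p)))))))))))"
    by (simp only: d on_CB_on_BB_commute[of j i k, symmetric]
        on_CB_on_CC_commute[of k i j, symmetric] on_CB_on_CC_commute[of i j k]
        on_BB_on_CC_commute[symmetric] not_False_eq_True)
  also have "\<dots> =
      r j i (r k j (r k i (b i j (b i k (b j k (c i j (c i k (c j k (s i k (s i j (s j k p)))))))))))"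
    by (simp only: d b_r_r not_False_eq_True)
  finally show ?thesis .
qed

lemma doubled_right_word:
  assumes d: "i \<noteq> j" "i \<noteq> k" "j \<noteq> k"
  shows "doubled j k (doubled i k (doubled i j p)) =
    r j i (r k j (r k i (b j k (b i k (b i j (c j k (c i k (c i j (s i k (s i j (s j k p)))))))))))"
proof -
  note d = d d[symmetric]
  have "doubled j k (doubled i k (doubled i j p)) =
      r k j (b j k (c j k (s j k (r k i (b i k (c i k (s i k (r j i (b i j (c i j (s i j p)))))))))))"
    by (simp only: doubled_def)
  \<comment> \<open>Bring \<open>s\<^sub>j\<^sub>k\<close> and \<open>r\<^sub>j\<^sub>i\<close> to the two sides of \<open>b\<^sub>i\<^sub>k\<close>; neither commutes with it, but they trade places across it.\<close>
  also have "\<dots> =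
      r k j (b j k (c j k (r k i (s j k (b i k (r j i (c i k (b i j (s i k (c i j (s i j p)))))))))))"
    by (simp only: d on_CB_commute[of j k k i] on_CB_commute[of i j k i]
        on_CB_on_BB_commute[of k i j] on_CB_on_CC_commute[of j i k] not_False_eq_True)
  also have "\<dots> =
      r k j (b j k (c j k (r k i (r j i (b i k (s j k (c i k (b i j (s i k (c i j (s i j p)))))))))))"
    by (simp only: d s_b_r not_False_eq_True)
  also have "\<dots> =
      r k j (b j k (c j k (r k i (r j i (b i k (c i k (b i j (s j k (s i k (c i j (s i j p)))))))))))"
    by (simp only: d on_CB_on_BB_commute[of k i j] on_CB_on_CC_commute[of j i k]
        not_False_eq_True)
  \<comment> \<open>The pair \<open>r\<^sub>k\<^sub>i, r\<^sub>j\<^sub>i\<close> passes \<open>c\<^sub>j\<^sub>k\<close>, and the pair \<open>s\<^sub>j\<^sub>k, s\<^sub>i\<^sub>k\<close> passes \<open>c\<^sub>i\<^sub>j\<close>.\<close>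
  also have "\<dots> =
      r k j (b j k (r j i (r k i (c j k (b i k (c i k (b i j (c i j (s i k (s j k (s i j p)))))))))))"
    by (simp only: d c_r_r s_s_c not_False_eq_True)
  also have "\<dots> =
      r j i (r k j (r k i (b j k (b i k (b i j (c j k (c i k (c i j (s i k (s i j (s j k p)))))))))))"
    by (simp only: d on_CB_commute[of k j j i] on_CB_commute[of j i k j]
        on_CB_on_BB_commute[of i j k, symmetric] on_BB_on_CC_commute not_False_eq_True)
  finally show ?thesis .
qed

lemma doubled_yang_baxter:
  assumes "yang_baxter RB" "yang_baxter RC" and d: "i \<noteq> j" "i \<noteq> k" "j \<noteq> k"
  shows "doubled i j (doubled i k (doubled j k p)) = doubled j k (doubled i k (doubled i j p))"
  by (simp only: doubled_left_word[OF d] doubled_right_word[OF d]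
      on_BB_yang_baxter[OF assms(1) d] on_CC_yang_baxter[OF assms(2) d])

end

text \<open>
  The coordinates at strands other than 1, 2, 3 are never touched; a common value there makes each
  action on triples correspond to an action on families.
\<close>

definition embed :: "('b \<times> 'c) \<times> ('b \<times> 'c) \<times> ('b \<times> 'c) \<Rightarrow> (nat \<Rightarrow> 'b) \<times> (nat \<Rightarrow> 'c)" where
  "embed = (\<lambda>((x, u), (y, v), (z, w)).
     ((\<lambda>_. undefined)(1 := x, 2 := y, 3 := z), (\<lambda>_. undefined)(1 := u, 2 := v, 3 := w)))"

lemma inj_embed: "inj (embed :: ('b \<times> 'c) \<times> ('b \<times> 'c) \<times> ('b \<times> 'c) \<Rightarrow> _)"
proof (rule injI)
  fix p q :: "('b \<times> 'c) \<times> ('b \<times> 'c) \<times> ('b \<times> 'c)"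
  assume "embed p = embed q"
  then have "fst (embed p) n = fst (embed q) n" "snd (embed p) n = snd (embed q) n" for n
    by simp_all
  from this[of 1] this[of 2] this[of 3] show "p = q"
    by (simp add: embed_def case_prod_beta prod_eq_iff)
qed

theorem theorem5p4:
  fixes RB :: "'b \<times> 'b \<Rightarrow> 'b \<times> 'b"
    and RC :: "'c \<times> 'c \<Rightarrow> 'c \<times> 'c"
    and R :: "'c \<times> 'b \<Rightarrow> 'c \<times> 'b"
  assumes "yang_baxter RB"
    and "yang_baxter RC"
    and "bij R"
    and "(triple_23 RB \<circ> triple_12 R \<circ> triple_13 R :: 'c \<times> 'b \<times> 'b \<Rightarrow> 'c \<times> 'b \<times> 'b)
         = triple_13 R \<circ> triple_12 R \<circ> triple_23 RB"
    and "(triple_12 RC \<circ> triple_23 R \<circ> triple_13 R :: 'c \<times> 'c \<times> 'b \<Rightarrow> 'c \<times> 'c \<times> 'b)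
         = triple_13 R \<circ> triple_23 R \<circ> triple_12 RC"
  shows "yang_baxter
           (quad_41 R \<circ> quad_13 RB \<circ> quad_24 RC \<circ> quad_23 (inv R)
             :: ('b \<times> 'c) \<times> ('b \<times> 'c) \<Rightarrow> ('b \<times> 'c) \<times> ('b \<times> 'c))"
proof -
  interpret mixed_pair RB RC R
    using assms by unfold_locales
  let ?T = "quad_41 R \<circ> quad_13 RB \<circ> quad_24 RC \<circ> quad_23 (inv R)"
  note letters = embed_def doubled_def on_BB_def on_CC_def on_CB_def
    quad_41_def quad_13_def quad_24_def quad_23_def
  have 12: "embed (triple_12 ?T p) = doubled 1 2 (embed p)" for p
    by (simp add: letters triple_12_def case_prod_beta prod_eq_iff fun_eq_iff)
  have 13: "embed (triple_13 ?T p) = doubled 1 3 (embed p)" for p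
    by (simp add: letters triple_13_def case_prod_beta prod_eq_iff fun_eq_iff)
  have 23: "embed (triple_23 ?T p) = doubled 2 3 (embed p)" for p
    by (simp add: letters triple_23_def
        case_prod_beta prod_eq_iff fun_eq_iff)
  show ?thesis
    unfolding yang_baxter_def
  proof (rule ext)
    fix p
    have "embed ((triple_12 ?T \<circ> triple_13 ?T \<circ> triple_23 ?T) p)
        = embed ((triple_23 ?T \<circ> triple_13 ?T \<circ> triple_12 ?T) p)"
      \<comment> \<open>Unfold only the outer compositions: those inside \<open>?T\<close> must stay for 12, 13, 23 to match.\<close>
      unfolding o_apply[of "_ \<circ> _" _ p] o_apply[of "triple_12 ?T"] o_apply[of "triple_23 ?T"]
        12 13 23
      by (rule doubled_yang_baxter[OF assms(1,2)]) simp_all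
    then show "(triple_12 ?T \<circ> triple_13 ?T \<circ> triple_23 ?T) p
        = (triple_23 ?T \<circ> triple_13 ?T \<circ> triple_12 ?T) p"
      by (rule injD[OF inj_embed])
  qed
qed

end
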